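(* Let $V$ be a non-trivial real or complex vector space equipped with inner products $\langle\cdot,\cdot\rangle_1$ and $\langle\cdot,\cdot\rangle_2$, and let $m$, $M$ and $E$ be as defined in the context. For (linearly) independent vectors $u$ and $v$ in $V$ let $\varphi$ and $\psi$ be defined by $0\le\varphi\le\pi$, $0\le\psi\le\pi$, \[ \cos\varphi=\frac{\operatorname{Re}\langle u,v\rangle_1}{\|u\|_1\|v\|_1}\quad\text{and}\quad\cos\psi=\frac{\operatorname{Re}\langle u,v\rangle_2}{\|u\|_2\|v\|_2}. \] Then \[ (m/M)\tan(\varphi/2)\le\tan(\psi/2)\le (M/m)\tan(\varphi/2). \] Equality holds in the right-hand inequality if and only if $(u,v)\in E$. Equality holds in the left-hand inequality if and only if $(u,-v)\in E$.
   Context: $V$ may be infinite-dimensional. Inner products are over the scalar field of $V$ (real or complex) and linear in the first variable; $\|v\|_j=\sqrt{\langle v,v\rangle_j}$ for $j=1,2$. Define \[ m=\inf_{0\ne v\in V}\frac{\|v\|_2}{\|v\|_1},\quad V_m=\{v\in V:\|v\|_2=m\|v\|_1\},\quad M=\sup_{0\ne v\in V}\frac{\|v\|_2}{\|v\|_1},\quad V_M=\{v\in V:\|v\|_2=M\|v\|_1\}, \] so $0\le m\le M\le\infty$, with the convention $0\cdot\infty=0$ (so $0\in V_M$ when $M=\infty$). For $j=1,2$ let \[ E_j=\Big\{(u,v): u,v\in V\setminus\{0\},\ \frac{u}{\|u\|_j}+\frac{v}{\|v\|_j}\in V_m,\ \frac{u}{\|u\|_j}-\frac{v}{\|v\|_j}\in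 V_M\Big\}. \] The sets $E_1$ and $E_2$ coincide, and $E$ denotes this common set. If $m=0$ or $M=\infty$, then $m/M$ is read as $0$ and $M/m$ as $+\infty$. *)

theory Defs
  imports "HOL-Analysis.Analysis"
begin

text \<open>
  Scalar fields that are \<open>\<real>\<close> or \<open>\<complex>\<close>. The class admits no other fields up to isomorphism: every
  \<open>x\<close> is a root of \<open>X\<^sup>2 - 2 (Re x) X + \<bar>x\<bar>\<^sup>2\<close>, hence algebraic over \<open>\<real>\<close>. Since
  \<open>x * conjugate x = \<bar>x\<bar>\<^sup>2\<close>, the norm determines the conjugation.
\<close>

class real_or_complex = real_normed_field +
  fixes conjugate :: "'a \<Rightarrow> 'a"
    and re_part :: "'a \<Rightarrow> real"
  assumes conjugate_add: "conjugate (x + y) = conjugate x + conjugate y"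
    and conjugate_mult: "conjugate (x * y) = conjugate x * conjugate y"
    and add_conjugate': "x + conjugate x = (2 * re_part x) *\<^sub>R 1"
    and mult_conjugate': "x * conjugate x = (norm x)\<^sup>2 *\<^sub>R 1"

lemma add_conjugate: "x + conjugate x = of_real (2 * re_part (x::'k::real_or_complex))"
  by (simp add: of_real_def add_conjugate')

lemma mult_conjugate: "x * conjugate x = of_real ((norm (x::'k::real_or_complex))\<^sup>2)"
  by (simp add: of_real_def mult_conjugate')

instantiation real :: real_or_complex
begin

definition conjugate_real :: "real \<Rightarrow> real" where "conjugate_real x = x"
definition re_part_real :: "real \<Rightarrow> real" where "re_part_real x = x"

instance
  by standard (simp_all add: conjugate_real_def re_part_real_def power2_eq_square)

end

instantiation complex :: real_or_complex
begin

definition conjugate_complex :: "complex \<Rightarrow> complex" where "conjugate_complex = cnj"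
definition re_part_complex :: "complex \<Rightarrow> real" where "re_part_complex = Re"

instance
proof
  fix x :: complex
  show "x * conjugate x = (norm x)\<^sup>2 *\<^sub>R 1"
    by (simp add: conjugate_complex_def scaleR_conv_of_real flip: complex_norm_square)
qed (simp_all add: conjugate_complex_def re_part_complex_def complex_add_cnj scaleR_conv_of_real)

end

text \<open>
  The library's class \<open>real_inner\<close> is real and allows only one inner product per type, hence the
  following locale. Conjugate symmetry makes \<open>ip v v\<close> real, so that positivity can be stated for
  its real part.
\<close>

locale inner_product = vector_space smul
  for smul :: "'k::real_or_complex \<Rightarrow> 'v::ab_group_add \<Rightarrow> 'v"  (infixr \<open>*s\<close> 75) +
  fixes ip :: "'v \<Rightarrow> 'v \<Rightarrow> 'k"
  assumes ip_add_left: "ip (u + v) w = ip u w + ip v w"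
    and ip_scale_left: "ip (a *s u) w = a * ip u w"
    and ip_conjugate: "ip v u = conjugate (ip u v)"
    and ip_pos: "v \<noteq> 0 \<Longrightarrow> re_part (ip v v) > 0"

definition ip_norm :: "('v \<Rightarrow> 'v \<Rightarrow> 'k::real_or_complex) \<Rightarrow> 'v \<Rightarrow> real" where
  "ip_norm ip v = sqrt (re_part (ip v v))"

definition ip_normalize ::
  "('k::real_or_complex \<Rightarrow> 'v \<Rightarrow> 'v) \<Rightarrow> ('v \<Rightarrow> 'v \<Rightarrow> 'k) \<Rightarrow> 'v \<Rightarrow> 'v" where
  "ip_normalize smul ip v = smul (of_real (1 / ip_norm ip v)) v"

locale two_inner_products =
  ip1: inner_product smul ip1 + ip2: inner_product smul ip2
  for smul :: "'k::real_or_complex \<Rightarrow> 'v::ab_group_add \<Rightarrow> 'v"  (infixr \<open>*s\<close> 75)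
    and ip1 ip2 :: "'v \<Rightarrow> 'v \<Rightarrow> 'k" +
  assumes nontrivial: "\<exists>v::'v. v \<noteq> 0"

definition norm_ratio_inf ::
  "('v::zero \<Rightarrow> 'v \<Rightarrow> 'k::real_or_complex) \<Rightarrow> ('v \<Rightarrow> 'v \<Rightarrow> 'k) \<Rightarrow> ereal" where
  "norm_ratio_inf ip1 ip2 = (INF v\<in>{v. v \<noteq> 0}. ereal (ip_norm ip2 v / ip_norm ip1 v))"

definition norm_ratio_sup ::
  "('v::zero \<Rightarrow> 'v \<Rightarrow> 'k::real_or_complex) \<Rightarrow> ('v \<Rightarrow> 'v \<Rightarrow> 'k) \<Rightarrow> ereal" where
  "norm_ratio_sup ip1 ip2 = (SUP v\<in>{v. v \<noteq> 0}. ereal (ip_norm ip2 v / ip_norm ip1 v))"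

text \<open>
  For \<open>c = \<infinity>\<close> the following set is \<open>{0}\<close>, because \<open>\<infinity> * 0 = 0\<close> in \<open>ereal\<close>.
\<close>

definition ratio_set ::
  "('v \<Rightarrow> 'v \<Rightarrow> 'k::real_or_complex) \<Rightarrow> ('v \<Rightarrow> 'v \<Rightarrow> 'k) \<Rightarrow> ereal \<Rightarrow> 'v set" where
  "ratio_set ip1 ip2 c = {v. ereal (ip_norm ip2 v) = c * ereal (ip_norm ip1 v)}"

text \<open>
  \<open>E\<^sub>j\<close> is the set below with \<open>ip = ip\<^sub>j\<close>; lemma \<open>extremal_pairs_eq\<close> shows \<open>E\<^sub>1 = E\<^sub>2\<close>.
\<close>

definition extremal_pairs_wrt ::
  "('v \<Rightarrow> 'v \<Rightarrow> 'k) \<Rightarrow> ('k::real_or_complex \<Rightarrow> 'v::ab_group_add \<Rightarrow> 'v) \<Rightarrow>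
    ('v \<Rightarrow> 'v \<Rightarrow> 'k) \<Rightarrow> ('v \<Rightarrow> 'v \<Rightarrow> 'k) \<Rightarrow> ('v \<times> 'v) set" where
  "extremal_pairs_wrt ip smul ip1 ip2 =
    {(u, v). u \<noteq> 0 \<and> v \<noteq> 0 \<and>
       ip_normalize smul ip u + ip_normalize smul ip v
         \<in> ratio_set ip1 ip2 (norm_ratio_inf ip1 ip2) \<and>
       ip_normalize smul ip u - ip_normalize smul ip v
         \<in> ratio_set ip1 ip2 (norm_ratio_sup ip1 ip2)}"

definition extremal_pairs ::
  "('k::real_or_complex \<Rightarrow> 'v::ab_group_add \<Rightarrow> 'v) \<Rightarrow>
    ('v \<Rightarrow> 'v \<Rightarrow> 'k) \<Rightarrow> ('v \<Rightarrow> 'v \<Rightarrow> 'k) \<Rightarrow> ('v \<times> 'v) set" where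
  "extremal_pairs smul ip1 ip2 = extremal_pairs_wrt ip1 smul ip1 ip2"

lemma re_part_add: "re_part (x + y) = re_part x + re_part (y::'k::real_or_complex)"
proof -
  have "of_real (2 * re_part (x + y)) = (of_real (2 * re_part x + 2 * re_part y) :: 'k)"
    by (simp only: of_real_add add_conjugate[symmetric] conjugate_add add_ac)
  then have "2 * re_part (x + y) = 2 * re_part x + 2 * re_part y"
    by (simp only: of_real_eq_iff)
  then show ?thesis by simp
qed

lemma conjugate_of_real: "conjugate (of_real r) = (of_real r :: 'k::real_or_complex)"
proof (cases "r = 0")
  case True
  then show ?thesis using conjugate_add[of "0::'k" 0] by simp
next
  case False
  have "of_real r * conjugate (of_real r) = (of_real r * of_real r :: 'k)"
    using mult_conjugate[of "of_real r :: 'k"] by (simp add: power2_eq_square flip: of_real_mult)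
  then show ?thesis using False by simp
qed

lemma re_part_of_real_mult: "re_part (of_real r * x) = r * re_part (x::'k::real_or_complex)"
proof -
  have "of_real (2 * re_part (of_real r * x)) = (of_real r * of_real (2 * re_part x) :: 'k)"
    by (simp only: add_conjugate[symmetric] conjugate_mult conjugate_of_real distrib_left)
  then have "2 * re_part (of_real r * x) = r * (2 * re_part x)"
    by (simp only: of_real_mult[symmetric] of_real_eq_iff)
  then show ?thesis by simp
qed

lemma re_part_conjugate: "re_part (conjugate x) = re_part (x::'k::real_or_complex)"
proof -
  have "x + conjugate x = conjugate (x + conjugate x)"
    unfolding add_conjugate conjugate_of_real ..
  then have "conjugate (conjugate x) = x"
    by (simp add: conjugate_add)
  then have "of_real (2 * re_part (conjugate x)) = (of_real (2 * re_part x) :: 'k)"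
    by (simp only: add_conjugate[symmetric] add.commute)
  then show ?thesis by (simp only: of_real_eq_iff)
qed

context inner_product
begin

abbreviation "R u v \<equiv> re_part (ip u v)"

lemma R_commute: "R u v = R v u"
  by (metis ip_conjugate re_part_conjugate)

lemma R_add_left: "R (u + v) w = R u w + R v w"
  by (simp add: ip_add_left re_part_add)

lemma R_add_right: "R w (u + v) = R w u + R w v"
  by (metis R_commute R_add_left)

lemma R_scale_left: "R (of_real r *s u) w = r * R u w"
  by (simp add: ip_scale_left re_part_of_real_mult)

lemma R_scale_right: "R w (of_real r *s u) = r * R w u"
  by (metis R_commute R_scale_left)

lemma R_diff_right: "R w (u - v) = R w u - R w v"
  using R_add_right[of w "u - v" v] by simp

lemma R_zero [simp]: "R 0 w = 0"
  using R_add_left[of 0 0 w] by simp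

lemma R_nonneg: "R v v \<ge> 0"
  by (cases "v = 0") (auto dest: ip_pos)

lemma norm_pos: "v \<noteq> 0 \<Longrightarrow> ip_norm ip v > 0"
  by (simp add: ip_norm_def ip_pos)

lemma norm_nonneg: "ip_norm ip v \<ge> 0"
  by (simp add: ip_norm_def R_nonneg)

lemma norm_sq: "(ip_norm ip v)\<^sup>2 = R v v"
  by (simp add: ip_norm_def R_nonneg)

lemma norm_scale: "r \<ge> 0 \<Longrightarrow> ip_norm ip (of_real r *s v) = r * ip_norm ip v"
  by (simp add: ip_norm_def R_scale_left R_scale_right real_sqrt_mult flip: mult.assoc)

lemma R_add_diff: "R (u + v) (u - v) = R u u - R v v"
  using R_commute[of u v] by (simp add: R_add_left R_diff_right)

lemma norm_normalize: "v \<noteq> 0 \<Longrightarrow> ip_norm ip (ip_normalize smul ip v) = 1"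
  using norm_pos[of v] by (simp add: ip_normalize_def norm_scale del: of_real_divide)

lemma normalize_orthogonal:
  assumes "u \<noteq> 0" "v \<noteq> 0"
  shows "R (ip_normalize smul ip u + ip_normalize smul ip v)
            (ip_normalize smul ip u - ip_normalize smul ip v) = 0"
  using assms by (simp add: R_add_diff norm_normalize flip: norm_sq)

lemma ip_normalize_change:
  assumes "inner_product smul ip'" "u \<noteq> 0" "v \<noteq> 0"
    and orth: "R (ip_normalize smul ip' u + ip_normalize smul ip' v)
                 (ip_normalize smul ip' u - ip_normalize smul ip' v) = 0"
  shows "\<exists>r>0. ip_normalize smul ip u = of_real r *s ip_normalize smul ip' u \<and>
               ip_normalize smul ip v = of_real r *s ip_normalize smul ip' v"
proof -
  interpret ip': inner_product smul ip' by fact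
  define a b where "a = ip_norm ip' u" and "b = ip_norm ip' v"
  define a' b' where "a' = ip_norm ip u" and "b' = ip_norm ip v"
  have pos: "a > 0" "b > 0" "a' > 0" "b' > 0"
    using assms by (auto simp: a_def b_def a'_def b'_def norm_pos ip'.norm_pos)
  have "(ip_norm ip (ip_normalize smul ip' u))\<^sup>2 = (ip_norm ip (ip_normalize smul ip' v))\<^sup>2"
    using orth by (simp add: R_add_diff norm_sq)
  then have "ip_norm ip (ip_normalize smul ip' u) = ip_norm ip (ip_normalize smul ip' v)"
    by (simp add: norm_nonneg)
  then have "1 / a * a' = 1 / b * b'"
    using pos unfolding ip_normalize_def a_def[symmetric] b_def[symmetric]
    by (simp add: norm_scale a'_def b'_def del: of_real_divide)
  then have eq: "a / a' = b / b'"
    using pos by (simp add: field_simps)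
  have "ip_normalize smul ip u = of_real (a / a') *s ip_normalize smul ip' u"
    using pos by (simp add: ip_normalize_def flip: a_def a'_def)
  moreover have "ip_normalize smul ip v = of_real (a / a') *s ip_normalize smul ip' v"
    unfolding eq using pos by (simp add: ip_normalize_def flip: b_def b'_def)
  ultimately show ?thesis using pos by (intro exI[of _ "a / a'"]) simp
qed

end

context two_inner_products
begin

lemma ratio_set_scale:
  assumes "x \<in> ratio_set ip1 ip2 c" "r > 0"
  shows "of_real r *s x \<in> ratio_set ip1 ip2 c"
proof -
  have "ereal (r * ip_norm ip2 x) = ereal r * (c * ereal (ip_norm ip1 x))"
    using assms by (simp add: ratio_set_def flip: times_ereal.simps(1))
  also have "\<dots> = c * ereal (r * ip_norm ip1 x)"
    by (simp add: mult.left_commute flip: times_ereal.simps(1))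
  finally show ?thesis
    using assms by (simp add: ratio_set_def ip1.norm_scale ip2.norm_scale)
qed

lemma norm_ratio_inf_real:
  obtains c where "norm_ratio_inf ip1 ip2 = ereal c" "c \<ge> 0"
    "\<And>v. c * ip_norm ip1 v \<le> ip_norm ip2 v"
proof -
  obtain w :: 'v where w: "w \<noteq> 0" using nontrivial by blast
  have le: "norm_ratio_inf ip1 ip2 \<le> ereal (ip_norm ip2 v / ip_norm ip1 v)" if "v \<noteq> 0" for v
    unfolding norm_ratio_inf_def using that by (intro INF_lower) simp
  have ge: "norm_ratio_inf ip1 ip2 \<ge> 0"
    unfolding norm_ratio_inf_def
    by (intro INF_greatest) (simp add: ip1.norm_nonneg ip2.norm_nonneg)
  obtain c where c: "norm_ratio_inf ip1 ip2 = ereal c"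
    using ge le[OF w] by (cases "norm_ratio_inf ip1 ip2") auto
  have "c * ip_norm ip1 v \<le> ip_norm ip2 v" for v
  proof (cases "v = 0")
    case True
    then show ?thesis by (simp add: ip_norm_def)
  next
    case False
    then show ?thesis
      using le[OF False] ip1.norm_pos[OF False] by (simp add: c field_simps)
  qed
  with c ge show thesis by (intro that) auto
qed

lemma quadratic_nonneg_imp_linear_zero:
  fixes D K :: real
  assumes "\<And>t. 2 * t * D + t\<^sup>2 * K \<ge> 0"
  shows "D = 0"
proof (rule ccontr)
  assume "D \<noteq> 0"
  define L where "L = \<bar>K\<bar> + 1"
  have L: "L > 0" "K < L * 2" by (auto simp: L_def)
  have "0 \<le> 2 * (- D / L) * D + (- D / L)\<^sup>2 * K" by (rule assms)
  also have "\<dots> = (D / L)\<^sup>2 * (K - L * 2)"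
    using L by (simp add: power2_eq_square field_simps)
  also have "\<dots> < 0"
    using L \<open>D \<noteq> 0\<close> by (intro mult_pos_neg) auto
  finally show False by simp
qed

lemma minimizer_orthogonal_iff:
  assumes "x \<in> ratio_set ip1 ip2 (norm_ratio_inf ip1 ip2)"
  shows "ip1.R x z = 0 \<longleftrightarrow> ip2.R x z = 0"
proof -
  obtain c where c: "norm_ratio_inf ip1 ip2 = ereal c" "c \<ge> 0"
    and le: "\<And>v. c * ip_norm ip1 v \<le> ip_norm ip2 v"
    using norm_ratio_inf_real by blast
  have x: "ip_norm ip2 x = c * ip_norm ip1 x"
    using assms by (simp add: ratio_set_def c)
  have sq_le: "c\<^sup>2 * ip1.R v v \<le> ip2.R v v" for v
    using power_mono[OF le[of v], of 2] c(2)
    by (simp add: power_mult_distrib ip1.norm_sq ip2.norm_sq ip1.norm_nonneg)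
  have sq_x: "ip2.R x x = c\<^sup>2 * ip1.R x x"
    by (simp add: x power_mult_distrib ip1.norm_sq flip: ip2.norm_sq)
  have "2 * t * (ip2.R x z - c\<^sup>2 * ip1.R x z) + t\<^sup>2 * (ip2.R z z - c\<^sup>2 * ip1.R z z) \<ge> 0" for t
    using sq_le[of "x + of_real t *s z"] sq_x ip1.R_commute[of z x] ip2.R_commute[of z x]
    by (simp add: ip1.R_add_left ip1.R_add_right ip1.R_scale_left ip1.R_scale_right
        ip2.R_add_left ip2.R_add_right ip2.R_scale_left ip2.R_scale_right
        algebra_simps power2_eq_square)
  then have eq: "ip2.R x z = c\<^sup>2 * ip1.R x z"
    using quadratic_nonneg_imp_linear_zero by fastforce
  show ?thesis
  proof (cases "c = 0")
    case True
    then have "x = 0" using x ip2.norm_pos[of x] by auto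
    then show ?thesis by simp
  next
    case False
    then show ?thesis by (simp add: eq)
  qed
qed

lemma extremal_pairs_wrt_mono:
  assumes "inner_product smul ip" "inner_product smul ip'"
    and orth: "\<And>x y. x \<in> ratio_set ip1 ip2 (norm_ratio_inf ip1 ip2) \<Longrightarrow>
                 re_part (ip x y) = 0 \<Longrightarrow> re_part (ip' x y) = 0"
  shows "extremal_pairs_wrt ip smul ip1 ip2 \<subseteq> extremal_pairs_wrt ip' smul ip1 ip2"
proof clarify
  interpret ip: inner_product smul ip by fact
  interpret ip': inner_product smul ip' by fact
  fix u v assume uv: "(u, v) \<in> extremal_pairs_wrt ip smul ip1 ip2"
  let ?u = "ip_normalize smul ip u" and ?v = "ip_normalize smul ip v"
  have nz: "u \<noteq> 0" "v \<noteq> 0"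
    and min: "?u + ?v \<in> ratio_set ip1 ip2 (norm_ratio_inf ip1 ip2)"
    and max: "?u - ?v \<in> ratio_set ip1 ip2 (norm_ratio_sup ip1 ip2)"
    using uv by (auto simp: extremal_pairs_wrt_def)
  obtain r where r: "r > 0" "ip_normalize smul ip' u = of_real r *s ?u"
      "ip_normalize smul ip' v = of_real r *s ?v"
    using ip'.ip_normalize_change[OF assms(1) nz] orth[OF min] ip.normalize_orthogonal[OF nz]
    by blast
  show "(u, v) \<in> extremal_pairs_wrt ip' smul ip1 ip2"
    using nz ratio_set_scale[OF min r(1)] ratio_set_scale[OF max r(1)]
    by (simp add: extremal_pairs_wrt_def r(2,3) ip1.scale_right_distrib
        ip1.scale_right_diff_distrib)
qed

lemma extremal_pairs_eq:
  "extremal_pairs_wrt ip1 smul ip1 ip2 = extremal_pairs_wrt ip2 smul ip1 ip2"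
  by (intro subset_antisym extremal_pairs_wrt_mono)
    (simp_all add: minimizer_orthogonal_iff ip1.inner_product_axioms ip2.inner_product_axioms)

end

end

theory Submission
  imports Defs
begin

text \<open>
  For a real inner product, \<open>tan\<^sup>2 (\<phi> / 2) = (1 - cos \<phi>) / (1 + cos \<phi>)\<close> is the quotient of the
  \<^emph>\<open>angle defects\<close> \<open>D u v = \<parallel>u\<parallel> \<parallel>v\<parallel> - Re \<langle>u, v\<rangle>\<close> and \<open>D u (- v)\<close>, so it suffices to compare
  the defects \<open>D\<^sub>1\<close> and \<open>D\<^sub>2\<close> of the two inner products.

  Let \<open>\<parallel>w\<parallel>\<^sub>2 \<le> K \<parallel>w\<parallel>\<^sub>1\<close> for all \<open>w\<close>, and apply this to \<open>w = u / \<parallel>u\<parallel>\<^sub>1 - v / \<parallel>v\<parallel>\<^sub>1\<close>. Here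
  \<open>\<parallel>w\<parallel>\<^sub>1\<^sup>2 = 2 D\<^sub>1 u v / (\<parallel>u\<parallel>\<^sub>1 \<parallel>v\<parallel>\<^sub>1)\<close>, whereas \<open>\<parallel>w\<parallel>\<^sub>2\<^sup>2\<close> exceeds
  \<open>2 D\<^sub>2 u v / (\<parallel>u\<parallel>\<^sub>1 \<parallel>v\<parallel>\<^sub>1)\<close> by the square \<open>(\<parallel>u\<parallel>\<^sub>2 / \<parallel>u\<parallel>\<^sub>1 - \<parallel>v\<parallel>\<^sub>2 / \<parallel>v\<parallel>\<^sub>1)\<^sup>2\<close>. Hence
  \<open>D\<^sub>2 u v \<le> K\<^sup>2 D\<^sub>1 u v\<close>, with equality iff this square vanishes and \<open>w\<close> attains the bound
  (lemmas \<open>defect_le\<close> and \<open>defect_eq_iff\<close>). With \<open>K = M\<close> this bounds the numerators. With the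
  inner products exchanged, \<open>K = 1 / m\<close>, and \<open>- v\<close> in place of \<open>v\<close>, it gives
  \<open>m\<^sup>2 D\<^sub>1 u (- v) \<le> D\<^sub>2 u (- v)\<close>, which bounds the denominators. Dividing yields the right-hand
  inequality, with equality iff both bounds are equalities.

  The equality case of the first bound involves the difference of the vectors normalized for the
  first inner product, that of the second bound the sum of those normalized for the second one.
  When \<open>\<parallel>u\<parallel>\<^sub>2 / \<parallel>u\<parallel>\<^sub>1 = \<parallel>v\<parallel>\<^sub>2 / \<parallel>v\<parallel>\<^sub>1\<close>, the two normalizations differ by a common factor, so
  both bounds are equalities iff this condition holds and \<open>(u, v) \<in> E\<close>. The condition itself
  follows from \<open>(u, v) \<in> E\<close> (lemmas \<open>extremal_iff\<close> and \<open>extremal_iff_defects\<close>).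

  Replacing \<open>v\<close> by \<open>- v\<close> turns both tangents into their reciprocals, and so the right-hand
  inequality into the left-hand one.

  If \<open>m = 0\<close> or \<open>M = \<infinity>\<close>, the inequalities are trivial and strict, and \<open>E\<close> contains no
  independent pair, because \<open>V\<^sub>m\<close> or \<open>V\<^sub>M\<close> is \<open>{0}\<close>.
\<close>

section \<open>Angle defects\<close>

text \<open>
  The amount by which the Cauchy-Schwarz inequality for \<open>Re \<langle>u, v\<rangle>\<close> fails to be an equality;
  it equals \<open>\<parallel>u\<parallel> \<parallel>v\<parallel> (1 - cos \<phi>)\<close>, where \<open>\<phi>\<close> is the angle between \<open>u\<close> and \<open>v\<close>.
\<close>

definition defect :: "('v \<Rightarrow> 'v \<Rightarrow> 'k::real_or_complex) \<Rightarrow> 'v \<Rightarrow> 'v \<Rightarrow> real" where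
  "defect ip u v = ip_norm ip u * ip_norm ip v - re_part (ip u v)"

context inner_product
begin

lemma R_minus_right: "R w (- v) = - R w v"
  using R_add_right[of w v "- v"] R_zero[of w] R_commute[of w 0] by simp

lemma norm_minus: "ip_norm ip (- v) = ip_norm ip v"
  using R_minus_right[of v v] R_minus_right[of "- v" v] R_commute[of v "- v"]
  by (simp add: ip_norm_def)

lemma normalize_minus: "ip_normalize smul ip (- v) = - ip_normalize smul ip v"
  by (simp add: ip_normalize_def norm_minus)

lemma defect_minus: "defect ip u (- v) = ip_norm ip u * ip_norm ip v + R u v"
  by (simp add: defect_def norm_minus R_minus_right)

lemma norm_sq_combination:
  "(ip_norm ip (of_real s *s u - of_real t *s v))\<^sup>2
     = s\<^sup>2 * (ip_norm ip u)\<^sup>2 - 2 * s * t * R u v + t\<^sup>2 * (ip_norm ip v)\<^sup>2"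
proof -
  have "R (x - y) (x - y) = R x x - 2 * R x y + R y y" for x y
    using R_add_left[of "x - y" y "x - y"] R_commute[of y x] by (simp add: R_diff_right)
  then show ?thesis
    unfolding norm_sq by (simp add: R_scale_left R_scale_right power2_eq_square)
qed

lemma norm_sq_normalize_diff:
  assumes "u \<noteq> 0" "v \<noteq> 0"
  shows "(ip_norm ip (ip_normalize smul ip u - ip_normalize smul ip v))\<^sup>2
           = 2 * defect ip u v / (ip_norm ip u * ip_norm ip v)"
  using norm_pos[OF assms(1)] norm_pos[OF assms(2)]
  unfolding ip_normalize_def norm_sq_combination defect_def
  by (simp add: field_simps power2_eq_square)

text \<open>
  Only independence over the reals matters for the geometry of the real parts; it is expressed by
  saying that \<open>v \<noteq> 0\<close> and \<open>u\<close> is not a real multiple of \<open>v\<close>.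
\<close>

lemma normalize_neq:
  assumes ind: "\<And>r. u \<noteq> smul (of_real r) v" and "v \<noteq> 0"
  shows "ip_normalize smul ip u \<noteq> ip_normalize smul ip v"
proof
  assume eq: "ip_normalize smul ip u = ip_normalize smul ip v"
  have pos: "ip_norm ip u > 0"
    using ind[of 0] by (intro norm_pos) simp
  have "u = of_real (ip_norm ip u) *s ip_normalize smul ip u"
    using pos by (simp add: ip_normalize_def)
  also have "\<dots> = of_real (ip_norm ip u / ip_norm ip v) *s v"
    unfolding eq by (simp add: ip_normalize_def divide_inverse)
  finally show False using ind by blast
qed

lemma independent_minus:
  assumes "\<And>r. u \<noteq> smul (of_real r) v"
  shows "u \<noteq> smul (of_real r) (- v)"
  using assms[of "- r"] by simp

lemma defect_pos:
  assumes ind: "\<And>r. u \<noteq> smul (of_real r) v" and v: "v \<noteq> 0"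
  shows "defect ip u v > 0"
proof -
  have u: "u \<noteq> 0" using ind[of 0] by simp
  let ?w = "ip_normalize smul ip u - ip_normalize smul ip v"
  have "ip_norm ip ?w > 0"
    using normalize_neq[OF assms] by (intro norm_pos) simp
  then have "2 * defect ip u v / (ip_norm ip u * ip_norm ip v) > 0"
    unfolding norm_sq_normalize_diff[OF u v, symmetric] by simp
  then show ?thesis
    using mult_pos_pos[OF norm_pos[OF u] norm_pos[OF v]] by (auto simp: zero_less_divide_iff)
qed

lemma tan_half_angle:
  assumes ind: "\<And>r. u \<noteq> smul (of_real r) v" and v: "v \<noteq> 0"
    and \<phi>: "0 \<le> \<phi>" "\<phi> \<le> pi" "cos \<phi> = R u v / (ip_norm ip u * ip_norm ip v)"
  shows "tan (\<phi> / 2) > 0" and "(tan (\<phi> / 2))\<^sup>2 = defect ip u v / defect ip u (- v)"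
proof -
  have u: "u \<noteq> 0" using ind[of 0] by simp
  have pos: "ip_norm ip u * ip_norm ip v > 0"
    using norm_pos[OF u] norm_pos[OF v] by simp
  have D: "defect ip u v = ip_norm ip u * ip_norm ip v * (1 - cos \<phi>)"
    and D': "defect ip u (- v) = ip_norm ip u * ip_norm ip v * (1 + cos \<phi>)"
    using u v norm_pos[OF u] norm_pos[OF v] unfolding \<phi>(3) defect_minus
    by (simp_all add: defect_def field_simps)
  have "defect ip u v > 0" "defect ip u (- v) > 0"
    using defect_pos[OF ind v] defect_pos[OF independent_minus[OF ind]] v by auto
  then have c: "1 - cos \<phi> > 0" "1 + cos \<phi> > 0"
    using pos unfolding D D' by (simp_all add: zero_less_mult_iff)
  have sin2: "(sin \<phi>)\<^sup>2 = (1 - cos \<phi>) * (1 + cos \<phi>)"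
    by (simp add: sin_squared_eq algebra_simps power2_eq_square)
  have "sin \<phi> \<ge> 0"
    using \<phi> by (intro sin_ge_zero) auto
  moreover have "sin \<phi> \<noteq> 0"
    using sin2 c by auto
  moreover have tan: "tan (\<phi> / 2) = sin \<phi> / (1 + cos \<phi>)"
    using tan_half[of "\<phi> / 2"] by (simp add: add.commute)
  ultimately show "tan (\<phi> / 2) > 0"
    using c by simp
  show "(tan (\<phi> / 2))\<^sup>2 = defect ip u v / defect ip u (- v)"
    unfolding tan power_divide sin2 D D' using pos c by (auto simp: power2_eq_square)
qed

end

section \<open>Comparison of the defects of two inner products\<close>

context two_inner_products
begin

lemma norm_sq_gap:
  assumes "u \<noteq> 0" "v \<noteq> 0"
  defines "w \<equiv> ip_normalize smul ip1 u - ip_normalize smul ip1 v"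
  shows "K\<^sup>2 * (ip_norm ip1 w)\<^sup>2 - (ip_norm ip2 w)\<^sup>2
           = 2 * (K\<^sup>2 * defect ip1 u v - defect ip2 u v) / (ip_norm ip1 u * ip_norm ip1 v)
             - (ip_norm ip2 u / ip_norm ip1 u - ip_norm ip2 v / ip_norm ip1 v)\<^sup>2"
proof -
  define p q where "p = ip_norm ip1 u" and "q = ip_norm ip1 v"
  have pos: "p > 0" "q > 0"
    using assms by (auto simp: p_def q_def ip1.norm_pos)
  have w2: "(ip_norm ip2 w)\<^sup>2 = (1 / p)\<^sup>2 * (ip_norm ip2 u)\<^sup>2 - 2 * (1 / p) * (1 / q) * ip2.R u v
          + (1 / q)\<^sup>2 * (ip_norm ip2 v)\<^sup>2"
    unfolding w_def ip_normalize_def ip2.norm_sq_combination p_def q_def ..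
  have w1: "(ip_norm ip1 w)\<^sup>2 = 2 * defect ip1 u v / (p * q)"
    unfolding w_def p_def q_def by (rule ip1.norm_sq_normalize_diff[OF assms(1,2)])
  show ?thesis
    using pos unfolding w1 w2 defect_def[of ip2] p_def[symmetric] q_def[symmetric]
    by (simp add: field_simps power2_eq_square)
qed

lemma
  assumes nz: "u \<noteq> 0" "v \<noteq> 0"
    and K: "K \<ge> 0" and bound: "\<And>w. ip_norm ip2 w \<le> K * ip_norm ip1 w"
  shows defect_le: "defect ip2 u v \<le> K\<^sup>2 * defect ip1 u v"
    and defect_eq_iff: "defect ip2 u v = K\<^sup>2 * defect ip1 u v \<longleftrightarrow>
      ip_norm ip2 u / ip_norm ip1 u = ip_norm ip2 v / ip_norm ip1 v \<and>
      ip_normalize smul ip1 u - ip_normalize smul ip1 v \<in> ratio_set ip1 ip2 (ereal K)"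
proof -
  let ?w = "ip_normalize smul ip1 u - ip_normalize smul ip1 v"
  define P where "P = ip_norm ip1 u * ip_norm ip1 v"
  define \<delta> where "\<delta> = ip_norm ip2 u / ip_norm ip1 u - ip_norm ip2 v / ip_norm ip1 v"
  define g where "g = (K * ip_norm ip1 ?w)\<^sup>2 - (ip_norm ip2 ?w)\<^sup>2"
  have P: "P > 0"
    using nz by (simp add: P_def ip1.norm_pos)
  have g: "g \<ge> 0"
    unfolding g_def using power_mono[OF bound ip2.norm_nonneg, of ?w 2] by simp
  have "g = 2 * (K\<^sup>2 * defect ip1 u v - defect ip2 u v) / P - \<delta>\<^sup>2"
    unfolding g_def power_mult_distrib P_def \<delta>_def by (rule norm_sq_gap[OF nz])
  then have eq: "2 * (K\<^sup>2 * defect ip1 u v - defect ip2 u v) = P * (g + \<delta>\<^sup>2)"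
    using P by simp
  have "2 * (K\<^sup>2 * defect ip1 u v - defect ip2 u v) \<ge> 0"
    unfolding eq using P g by simp
  then show "defect ip2 u v \<le> K\<^sup>2 * defect ip1 u v"
    by simp
  have "defect ip2 u v = K\<^sup>2 * defect ip1 u v \<longleftrightarrow> P * (g + \<delta>\<^sup>2) = 0"
    unfolding eq[symmetric] by auto
  also have "\<dots> \<longleftrightarrow> \<delta> = 0 \<and> g = 0"
    using P g by (auto simp: add_nonneg_eq_0_iff)
  also have "g = 0 \<longleftrightarrow> ip_norm ip2 ?w = K * ip_norm ip1 ?w"
    using K ip1.norm_nonneg[of ?w] ip2.norm_nonneg[of ?w]
    by (auto simp: g_def power2_eq_iff_nonneg)
  finally show "defect ip2 u v = K\<^sup>2 * defect ip1 u v \<longleftrightarrow>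
      ip_norm ip2 u / ip_norm ip1 u = ip_norm ip2 v / ip_norm ip1 v \<and>
      ?w \<in> ratio_set ip1 ip2 (ereal K)"
    by (simp add: \<delta>_def ratio_set_def)
qed

lemma two_inner_products_swap: "two_inner_products smul ip2 ip1"
  by (simp add: two_inner_products_def two_inner_products_axioms_def nontrivial
      ip1.inner_product_axioms ip2.inner_product_axioms)

text \<open>
  The companion lower bound is the upper bound applied to the exchanged inner products, to
  \<open>K = 1 / c\<close>, and to the pair \<open>(u, - v)\<close>.
\<close>

lemma
  assumes nz: "u \<noteq> 0" "v \<noteq> 0"
    and c: "c > 0" and bound: "\<And>w. c * ip_norm ip1 w \<le> ip_norm ip2 w"
  shows defect_minus_ge: "c\<^sup>2 * defect ip1 u (- v) \<le> defect ip2 u (- v)"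
    and defect_minus_eq_iff: "defect ip2 u (- v) = c\<^sup>2 * defect ip1 u (- v) \<longleftrightarrow>
      ip_norm ip2 u / ip_norm ip1 u = ip_norm ip2 v / ip_norm ip1 v \<and>
      ip_normalize smul ip2 u + ip_normalize smul ip2 v \<in> ratio_set ip1 ip2 (ereal c)"
proof -
  interpret swap: two_inner_products smul ip2 ip1
    by (rule two_inner_products_swap)
  have bound': "ip_norm ip1 w \<le> 1 / c * ip_norm ip2 w" for w
    using bound[of w] c by (simp add: field_simps)
  have nz': "- v \<noteq> 0" "1 / c \<ge> 0"
    using nz c by auto
  have pos: "ip_norm ip1 u > 0" "ip_norm ip1 v > 0" "ip_norm ip2 u > 0" "ip_norm ip2 v > 0"
    using nz by (auto simp: ip1.norm_pos ip2.norm_pos)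
  show "c\<^sup>2 * defect ip1 u (- v) \<le> defect ip2 u (- v)"
    using swap.defect_le[OF nz(1) nz' bound'] c by (simp add: field_simps)
  have "defect ip2 u (- v) = c\<^sup>2 * defect ip1 u (- v) \<longleftrightarrow>
      defect ip1 u (- v) = (1 / c)\<^sup>2 * defect ip2 u (- v)"
    using c by (auto simp: field_simps)
  also have "\<dots> \<longleftrightarrow> ip_norm ip1 u / ip_norm ip2 u = ip_norm ip1 v / ip_norm ip2 v \<and>
      ip_normalize smul ip2 u + ip_normalize smul ip2 v \<in> ratio_set ip2 ip1 (ereal (1 / c))"
    unfolding swap.defect_eq_iff[OF nz(1) nz' bound']
    by (simp add: ip1.norm_minus ip2.norm_minus ip2.normalize_minus)
  also have "ip_norm ip1 u / ip_norm ip2 u = ip_norm ip1 v / ip_norm ip2 v \<longleftrightarrow>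
      ip_norm ip2 u / ip_norm ip1 u = ip_norm ip2 v / ip_norm ip1 v"
    using pos by (auto simp: field_simps)
  also have "ratio_set ip2 ip1 (ereal (1 / c)) = ratio_set ip1 ip2 (ereal c)"
    using c by (auto simp: ratio_set_def field_simps)
  finally show "defect ip2 u (- v) = c\<^sup>2 * defect ip1 u (- v) \<longleftrightarrow>
      ip_norm ip2 u / ip_norm ip1 u = ip_norm ip2 v / ip_norm ip1 v \<and>
      ip_normalize smul ip2 u + ip_normalize smul ip2 v \<in> ratio_set ip1 ip2 (ereal c)" .
qed

section \<open>Extremal pairs\<close>

lemma normalize_change_of_ratio:
  assumes "u \<noteq> 0" "v \<noteq> 0"
    and "ip_norm ip2 u / ip_norm ip1 u = ip_norm ip2 v / ip_norm ip1 v"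
  shows "ip_normalize smul ip1 u + ip_normalize smul ip1 v =
    of_real (ip_norm ip2 u / ip_norm ip1 u) *s (ip_normalize smul ip2 u + ip_normalize smul ip2 v)"
proof -
  have "ip_normalize smul ip1 x =
      of_real (ip_norm ip2 x / ip_norm ip1 x) *s ip_normalize smul ip2 x" if "x \<noteq> 0" for x
    using ip2.norm_pos[OF that] by (simp add: ip_normalize_def divide_inverse)
  then show ?thesis
    unfolding ip1.scale_right_distrib using assms by metis
qed

text \<open>
  Here the difference is normalized for the first inner product and the sum for the second one, as
  they arise in the equality cases of the two bounds on defects.
\<close>

lemma extremal_iff:
  assumes nz: "u \<noteq> 0" "v \<noteq> 0"
  shows "(u, v) \<in> extremal_pairs smul ip1 ip2 \<longleftrightarrow>
    ip_norm ip2 u / ip_norm ip1 u = ip_norm ip2 v / ip_norm ip1 v \<and>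
    ip_normalize smul ip1 u - ip_normalize smul ip1 v
      \<in> ratio_set ip1 ip2 (norm_ratio_sup ip1 ip2) \<and>
    ip_normalize smul ip2 u + ip_normalize smul ip2 v
      \<in> ratio_set ip1 ip2 (norm_ratio_inf ip1 ip2)" (is "?L \<longleftrightarrow> ?ratio \<and> ?max \<and> ?min")
proof
  assume L: ?L
  let ?u = "ip_normalize smul ip1 u" and ?v = "ip_normalize smul ip1 v"
  have max: ?max and min1: "?u + ?v \<in> ratio_set ip1 ip2 (norm_ratio_inf ip1 ip2)"
    using L by (auto simp: extremal_pairs_def extremal_pairs_wrt_def)
  have min: ?min
    using L unfolding extremal_pairs_def extremal_pairs_eq by (auto simp: extremal_pairs_wrt_def)
  \<comment> \<open>The sum and difference of the normalized vectors are orthogonal for the first inner product,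
      hence for the second one as well, since the sum minimizes the norm ratio.\<close>
  have "ip2.R (?u + ?v) (?u - ?v) = 0"
    using minimizer_orthogonal_iff[OF min1] ip1.normalize_orthogonal[OF nz] by blast
  then have "(ip_norm ip2 ?u)\<^sup>2 = (ip_norm ip2 ?v)\<^sup>2"
    by (simp add: ip2.R_add_diff ip2.norm_sq)
  then have "ip_norm ip2 ?u = ip_norm ip2 ?v"
    by (simp add: ip2.norm_nonneg)
  then have ?ratio
    by (simp add: ip_normalize_def ip2.norm_scale ip1.norm_nonneg del: of_real_divide)
  with max min show "?ratio \<and> ?max \<and> ?min" by blast
next
  assume R: "?ratio \<and> ?max \<and> ?min"
  have "ip_norm ip2 u / ip_norm ip1 u > 0"
    using nz by (simp add: ip1.norm_pos ip2.norm_pos)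
  then have "ip_normalize smul ip1 u + ip_normalize smul ip1 v
      \<in> ratio_set ip1 ip2 (norm_ratio_inf ip1 ip2)"
    using R normalize_change_of_ratio[OF nz] ratio_set_scale by metis
  then show ?L
    using R nz by (simp add: extremal_pairs_def extremal_pairs_wrt_def)
qed

lemma extremal_iff_defects:
  assumes nz: "u \<noteq> 0" "v \<noteq> 0"
    and inf: "norm_ratio_inf ip1 ip2 = ereal c" "c > 0" "\<And>w. c * ip_norm ip1 w \<le> ip_norm ip2 w"
    and sup: "norm_ratio_sup ip1 ip2 = ereal C" "C > 0" "\<And>w. ip_norm ip2 w \<le> C * ip_norm ip1 w"
  shows "(u, v) \<in> extremal_pairs smul ip1 ip2 \<longleftrightarrow>
    defect ip2 u v = C\<^sup>2 * defect ip1 u v \<and> defect ip2 u (- v) = c\<^sup>2 * defect ip1 u (- v)"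
  using sup(2) extremal_iff[OF nz] defect_eq_iff[OF nz _ sup(3)]
    defect_minus_eq_iff[OF nz inf(2,3)]
  by (auto simp: inf(1) sup(1))

section \<open>The right-hand inequality\<close>

lemma norm_ratio_sup_cases:
  obtains "norm_ratio_sup ip1 ip2 = \<infinity>"
  | C where "norm_ratio_sup ip1 ip2 = ereal C" "C > 0" "\<And>w. ip_norm ip2 w \<le> C * ip_norm ip1 w"
proof -
  obtain x :: 'v where x: "x \<noteq> 0" using nontrivial by blast
  have le: "ereal (ip_norm ip2 w / ip_norm ip1 w) \<le> norm_ratio_sup ip1 ip2" if "w \<noteq> 0" for w
    unfolding norm_ratio_sup_def using that by (intro SUP_upper) simp
  have xpos: "ip_norm ip2 x / ip_norm ip1 x > 0"
    using x by (simp add: ip1.norm_pos ip2.norm_pos)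
  show thesis
  proof (cases "norm_ratio_sup ip1 ip2")
    case (real C)
    have "ip_norm ip2 w \<le> C * ip_norm ip1 w" for w
    proof (cases "w = 0")
      case True
      then show ?thesis by (simp add: ip_norm_def)
    next
      case False
      then show ?thesis
        using le[OF False] ip1.norm_pos[OF False] by (simp add: real field_simps)
    qed
    moreover have "C > 0"
      using le[OF x] xpos by (simp add: real)
    ultimately show thesis using real that(2) by blast
  qed (use le[OF x] that(1) in auto)
qed

lemma ratio_set_degenerate:
  "ratio_set ip1 ip2 0 \<subseteq> {0}" "ratio_set ip1 ip2 \<infinity> \<subseteq> {0}"
  using ip1.norm_pos ip2.norm_pos by (force simp: ratio_set_def)+

lemma not_extremal_degenerate:
  assumes ind: "\<And>r. u \<noteq> smul (of_real r) v" and v: "v \<noteq> 0"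
    and deg: "norm_ratio_inf ip1 ip2 = 0 \<or> norm_ratio_sup ip1 ip2 = \<infinity>"
  shows "(u, v) \<notin> extremal_pairs smul ip1 ip2"
proof -
  have "ip_normalize smul ip1 u \<noteq> ip_normalize smul ip1 v"
    using ip1.normalize_neq[OF assms(1,2)] .
  moreover have "ip_normalize smul ip1 u + ip_normalize smul ip1 v \<noteq> 0"
    using ip1.normalize_neq[OF ip1.independent_minus[OF ind]] v
    by (simp add: ip1.normalize_minus eq_neg_iff_add_eq_0)
  ultimately show ?thesis
    using deg ratio_set_degenerate
    by (auto simp: extremal_pairs_def extremal_pairs_wrt_def)
qed

lemma norm_ratio_cases:
  obtains (degenerate) "norm_ratio_inf ip1 ip2 = 0 \<or> norm_ratio_sup ip1 ip2 = \<infinity>"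
      "norm_ratio_inf ip1 ip2 / norm_ratio_sup ip1 ip2 = 0"
      "norm_ratio_sup ip1 ip2 / norm_ratio_inf ip1 ip2 = \<infinity>"
  | (regular) c C where
      "norm_ratio_inf ip1 ip2 = ereal c" "c > 0" "\<And>w. c * ip_norm ip1 w \<le> ip_norm ip2 w"
      "norm_ratio_sup ip1 ip2 = ereal C" "C > 0" "\<And>w. ip_norm ip2 w \<le> C * ip_norm ip1 w"
proof -
  obtain c where c: "norm_ratio_inf ip1 ip2 = ereal c" "c \<ge> 0"
    "\<And>w. c * ip_norm ip1 w \<le> ip_norm ip2 w"
    using norm_ratio_inf_real by blast
  show thesis
  proof (cases rule: norm_ratio_sup_cases)
    case 1
    then show thesis
      using c(1,2) by (intro degenerate) (auto simp: divide_ereal_def)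
  next
    case (2 C)
    show thesis
    proof (cases "c = 0")
      case True
      then show thesis
        using 2(1,2) c(1) by (intro degenerate) (auto simp: divide_ereal_def)
    next
      case False
      then show thesis
        using 2 c by (intro regular[of c C]) auto
    qed
  qed
qed

text \<open>
  The numbers \<open>s\<close> and \<open>t\<close> stand for the tangents of the half angles. Stating the inequality for
  them, rather than for angles, allows it to be applied also to \<open>(u, - v)\<close> and the reciprocals.
\<close>

lemma tangent_comparison:
  assumes ind: "\<And>r. u \<noteq> smul (of_real r) v" and v: "v \<noteq> 0"
    and s: "s > 0" "s\<^sup>2 = defect ip1 u v / defect ip1 u (- v)"
    and t: "t > 0" "t\<^sup>2 = defect ip2 u v / defect ip2 u (- v)"
  defines "q \<equiv> norm_ratio_sup ip1 ip2 / norm_ratio_inf ip1 ip2"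
  shows "ereal t \<le> q * ereal s"
    and "ereal t = q * ereal s \<longleftrightarrow> (u, v) \<in> extremal_pairs smul ip1 ip2"
proof -
  have "ereal t \<le> q * ereal s \<and>
    (ereal t = q * ereal s \<longleftrightarrow> (u, v) \<in> extremal_pairs smul ip1 ip2)"
  proof (cases rule: norm_ratio_cases)
    case degenerate
    then show ?thesis
      using s(1) not_extremal_degenerate[OF ind v] by (simp add: q_def)
  next
    case (regular c C)
    have u: "u \<noteq> 0" using ind[of 0] by simp
    define a a' b b' where "a = defect ip1 u v" and "a' = defect ip1 u (- v)"
      and "b = defect ip2 u v" and "b' = defect ip2 u (- v)"
    have pos: "a > 0" "a' > 0" "b > 0" "b' > 0"
      using ip1.defect_pos[OF ind v] ip1.defect_pos[OF ip1.independent_minus[OF ind]]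
        ip2.defect_pos[OF ind v] ip2.defect_pos[OF ip1.independent_minus[OF ind]] v
      by (auto simp: a_def a'_def b_def b'_def)
    have b: "b \<le> C\<^sup>2 * a"
      unfolding a_def b_def using regular(5) by (intro defect_le[OF u v _ regular(6)]) simp
    have b': "c\<^sup>2 * a' \<le> b'"
      unfolding a'_def b'_def by (rule defect_minus_ge[OF u v regular(2,3)])
    have c2: "c\<^sup>2 * a' > 0"
      using regular(2) pos by simp
    have sq: "(C / c * s)\<^sup>2 = C\<^sup>2 * a / (c\<^sup>2 * a')" "t\<^sup>2 = b / b'"
      using s t by (simp_all add: power_mult_distrib power_divide a_def a'_def b_def b'_def)
    have nonneg: "C / c * s \<ge> 0"
      using regular(2,5) s(1) by simp
    have "t\<^sup>2 \<le> (C / c * s)\<^sup>2"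
      unfolding sq using b b' c2 pos by (intro frac_le) auto
    then have le: "t \<le> C / c * s"
      using nonneg by (rule power2_le_imp_le)
    have "t = C / c * s \<longleftrightarrow> t\<^sup>2 = (C / c * s)\<^sup>2"
      using nonneg t(1) by (simp add: power2_eq_iff_nonneg)
    also have "\<dots> \<longleftrightarrow> b = C\<^sup>2 * a \<and> b' = c\<^sup>2 * a'"
      unfolding sq
    proof
      \<comment> \<open>Equal quotients force equality in both bounds, since all the numbers are positive.\<close>
      assume eq: "b / b' = C\<^sup>2 * a / (c\<^sup>2 * a')"
      have "b / b' \<le> C\<^sup>2 * a / b'"
        using b pos by (intro divide_right_mono) auto
      moreover have "C\<^sup>2 * a > 0"
        using b pos by linarith
      ultimately have "b' \<le> c\<^sup>2 * a'"
        unfolding eq using c2 pos(4) by (metis divide_strict_left_mono mult_pos_pos not_le)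
      then have "b' = c\<^sup>2 * a'"
        using b' by simp
      then show "b = C\<^sup>2 * a \<and> b' = c\<^sup>2 * a'"
        using eq pos regular(2) by simp
    qed simp
    also have "\<dots> \<longleftrightarrow> (u, v) \<in> extremal_pairs smul ip1 ip2"
      unfolding a_def a'_def b_def b'_def
      by (rule extremal_iff_defects[OF u v regular, symmetric])
    finally show ?thesis
      using le regular(2) by (simp add: q_def regular(1,4))
  qed
  then show "ereal t \<le> q * ereal s"
    and "ereal t = q * ereal s \<longleftrightarrow> (u, v) \<in> extremal_pairs smul ip1 ip2"
    by blast+
qed

section \<open>Both inequalities\<close>

lemma reciprocal_comparison:
  assumes "s > 0" "t > 0"
  defines "m \<equiv> norm_ratio_inf ip1 ip2" and "M \<equiv> norm_ratio_sup ip1 ip2"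
  shows "m / M * ereal s \<le> ereal t \<longleftrightarrow> ereal (1 / t) \<le> M / m * ereal (1 / s)"
    and "m / M * ereal s = ereal t \<longleftrightarrow> ereal (1 / t) = M / m * ereal (1 / s)"
proof -
  have "(m / M * ereal s \<le> ereal t \<longleftrightarrow> ereal (1 / t) \<le> M / m * ereal (1 / s)) \<and>
    (m / M * ereal s = ereal t \<longleftrightarrow> ereal (1 / t) = M / m * ereal (1 / s))"
  proof (cases rule: norm_ratio_cases)
    case degenerate
    then show ?thesis
      using assms(1,2) by (simp add: m_def M_def)
  next
    case (regular c C)
    then show ?thesis
      using assms(1,2) by (auto simp: m_def M_def field_simps)
  qed
  then show "m / M * ereal s \<le> ereal t \<longleftrightarrow> ereal (1 / t) \<le> M / m * ereal (1 / s)"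
    and "m / M * ereal s = ereal t \<longleftrightarrow> ereal (1 / t) = M / m * ereal (1 / s)"
    by blast+
qed

end

theorem theorem2p4:
  fixes smul :: "'k::real_or_complex \<Rightarrow> 'v::ab_group_add \<Rightarrow> 'v"
    and ip1 ip2 :: "'v \<Rightarrow> 'v \<Rightarrow> 'k"
    and u v :: 'v
    and \<phi> \<psi> :: real
  assumes "two_inner_products smul ip1 ip2"
    and "u \<noteq> v" and "\<not> module.dependent smul {u, v}"
    and "0 \<le> \<phi>" and "\<phi> \<le> pi"
    and "cos \<phi> = re_part (ip1 u v) / (ip_norm ip1 u * ip_norm ip1 v)"
    and "0 \<le> \<psi>" and "\<psi> \<le> pi"
    and "cos \<psi> = re_part (ip2 u v) / (ip_norm ip2 u * ip_norm ip2 v)"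
  defines "m \<equiv> norm_ratio_inf ip1 ip2"
    and "M \<equiv> norm_ratio_sup ip1 ip2"
    and "E \<equiv> extremal_pairs smul ip1 ip2"
  shows "m / M * ereal (tan (\<phi> / 2)) \<le> ereal (tan (\<psi> / 2)) \<and>
         ereal (tan (\<psi> / 2)) \<le> M / m * ereal (tan (\<phi> / 2)) \<and>
         (ereal (tan (\<psi> / 2)) = M / m * ereal (tan (\<phi> / 2)) \<longleftrightarrow> (u, v) \<in> E) \<and>
         (m / M * ereal (tan (\<phi> / 2)) = ereal (tan (\<psi> / 2)) \<longleftrightarrow> (u, - v) \<in> E)"
proof -
  interpret two_inner_products smul ip1 ip2 by fact
  have v: "v \<noteq> 0"
    using assms(3) ip1.dependent_zero[of "{u, v}"] by auto
  have ind: "u \<noteq> smul (of_real r) v" for r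
  proof
    assume "u = smul (of_real r) v"
    then have "u \<in> ip1.span {v}"
      by (simp add: ip1.span_base ip1.span_scale)
    moreover have "{u, v} - {u} = {v}"
      using assms(2) by auto
    ultimately show False
      using assms(3) unfolding ip1.dependent_def by auto
  qed
  define s t where "s = tan (\<phi> / 2)" and "t = tan (\<psi> / 2)"
  have s: "s > 0" "s\<^sup>2 = defect ip1 u v / defect ip1 u (- v)"
    unfolding s_def using ip1.tan_half_angle[OF ind v assms(4-6)] by blast+
  have t: "t > 0" "t\<^sup>2 = defect ip2 u v / defect ip2 u (- v)"
    unfolding t_def using ip2.tan_half_angle[OF ind v assms(7-9)] by blast+
  have s': "1 / s > 0" "(1 / s)\<^sup>2 = defect ip1 u (- v) / defect ip1 u (- (- v))"
    and t': "1 / t > 0" "(1 / t)\<^sup>2 = defect ip2 u (- v) / defect ip2 u (- (- v))"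
    using s t by (simp_all add: power_one_over)
  have v': "- v \<noteq> 0" using v by simp
  note right = tangent_comparison[OF ind v s t]
  note left = tangent_comparison[OF ip1.independent_minus[OF ind] v' s' t']
  show ?thesis
    using right left reciprocal_comparison[OF s(1) t(1)]
    unfolding m_def M_def E_def s_def[symmetric] t_def[symmetric] by blast
qed

end
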